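(* Let $\ddot{\mathbb A}$ be a full relational BiKAT over a set of states $\Sigma$. For all relations $c,d,R,S$ on $\Sigma$: (i) the forward simulation $\forall\sigma,\sigma',\tau.\ \sigma R\sigma'\wedge\sigma\,c\,\tau\Rightarrow\exists\tau'.\ \sigma'\,d\,\tau'\wedge\tau S\tau'$ holds if and only if there is $W\in\ddot{\mathbb A}$ with $\dot R;W\le\dot R;W;\dot S$, $\dot R;\langle c]\le W;[\mathbf{hav}\rangle$ and $\dot R;W\le\langle\mathbf{hav}\mid d\rangle$; (ii) the backward simulation $\forall\sigma,\tau,\tau'.\ \sigma\,c\,\tau\wedge\tau S\tau'\Rightarrow\exists\sigma'.\ \sigma R\sigma'\wedge\sigma'\,d\,\tau'$ holds if and only if there is $W\in\ddot{\mathbb A}$ with $W;\dot S\le\dot R;W;\dot S$, $\langle c];\dot S\le[\mathbf{hav}\rangle;W$ and $W;\dot S\le\langle\mathbf{hav}\mid d\rangle$.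
   Context: A full relational BiKAT over $\Sigma$: the underlying KAT consists of all relations on $\Sigma$ with all sub-identities as tests ($1=id_\Sigma$, $0=\emptyset$, $;$ composition, $+$ union, ${}^*$ reflexive-transitive closure, $\neg p=id_\Sigma\setminus p$, $\le$ inclusion), and the BiKAT $\ddot{\mathbb A}$ consists of all relations on $\Sigma\times\Sigma$ with all sub-identities of $\Sigma\times\Sigma$ as tests, with the same operations. $\mathbf{hav}=\Sigma\times\Sigma$ is the top relation on $\Sigma$. $\langle c]=c\otimes id_\Sigma$, $[c\rangle=id_\Sigma\otimes c$, $\langle c\mid d\rangle=\langle c];[d\rangle$, where $(\sigma,\sigma')(R\otimes S)(\tau,\tau')$ iff $\sigma R\tau\wedge\sigma' S\tau'$. $\dot R$ is the sub-identity on $\Sigma\times\Sigma$ containing $((\sigma,\sigma'),(\sigma,\sigma'))$ iff $\sigma R\sigma'$. *)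

theory Defs
  imports Main
begin

text \<open>
  The full relational KAT over a set of states \<open>X\<close> has carrier \<open>rel_kat X\<close> and tests
  \<open>rel_tests X\<close>. Sequential composition is \<open>(O)\<close>, the order is \<open>(\<subseteq>)\<close>, the unit is
  \<open>Id_on X\<close>, and the top element is \<open>hav X\<close>.
\<close>

definition rel_kat :: "'a set \<Rightarrow> 'a rel set" where
  "rel_kat X = Pow (X \<times> X)"

definition rel_tests :: "'a set \<Rightarrow> 'a rel set" where
  "rel_tests X = Pow (Id_on X)"

definition hav :: "'a set \<Rightarrow> 'a rel" where
  "hav X = X \<times> X"

definition bikat :: "'a set \<Rightarrow> ('a \<times> 'a) rel set" where
  "bikat X = rel_kat (X \<times> X)"

definition bitests :: "'a set \<Rightarrow> ('a \<times> 'a) rel set" where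
  "bitests X = rel_tests (X \<times> X)"

definition tensor :: "'a rel \<Rightarrow> 'a rel \<Rightarrow> ('a \<times> 'a) rel" where
  "tensor R S = {((s, s'), (t, t')) | s s' t t'. (s, t) \<in> R \<and> (s', t') \<in> S}"

definition lemb :: "'a set \<Rightarrow> 'a rel \<Rightarrow> ('a \<times> 'a) rel" where
  "lemb X c = tensor c (Id_on X)"

definition remb :: "'a set \<Rightarrow> 'a rel \<Rightarrow> ('a \<times> 'a) rel" where
  "remb X c = tensor (Id_on X) c"

definition biprod :: "'a set \<Rightarrow> 'a rel \<Rightarrow> 'a rel \<Rightarrow> ('a \<times> 'a) rel" where
  "biprod X c d = lemb X c O remb X d"

definition dot :: "'a rel \<Rightarrow> ('a \<times> 'a) rel" where
  "dot R = {((s, s'), (s, s')) | s s'. (s, s') \<in> R}"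

lemma lemb_in_bikat: "c \<in> rel_kat X \<Longrightarrow> lemb X c \<in> bikat X"
  by (auto simp: rel_kat_def bikat_def lemb_def tensor_def)

lemma remb_in_bikat: "c \<in> rel_kat X \<Longrightarrow> remb X c \<in> bikat X"
  by (auto simp: rel_kat_def bikat_def remb_def tensor_def)

lemma dot_in_bitests: "R \<in> rel_kat X \<Longrightarrow> dot R \<in> bitests X"
  by (auto simp: rel_kat_def bitests_def rel_tests_def dot_def)

lemma bitests_subset_bikat: "bitests X \<subseteq> bikat X"
  by (auto simp: bitests_def rel_tests_def bikat_def rel_kat_def)

end

theory Submission
  imports Defs
begin

text \<open>
  In both directions the alignment witness is \<open>W = dot R O tensor c d O dot S\<close>, the pairs of
  runs of \<open>c\<close> and \<open>d\<close> that start in \<open>R\<close> and end in \<open>S\<close>. Conversely, the adequacy condition on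
  \<open>lemb X c\<close> extracts from any \<open>W\<close> the required state of the right-hand run, and the other two
  conditions say that it satisfies the relation and is a \<open>d\<close>-step.
\<close>

lemma mem_tensor_iff [simp]:
  "((s, s'), (t, t')) \<in> tensor A B \<longleftrightarrow> (s, t) \<in> A \<and> (s', t') \<in> B"
  by (simp add: tensor_def)

lemma mem_dot_relcomp_iff [simp]: "((s, s'), q) \<in> dot R O W \<longleftrightarrow> (s, s') \<in> R \<and> ((s, s'), q) \<in> W"
  by (auto simp: dot_def)

lemma mem_relcomp_dot_iff [simp]: "(p, (t, t')) \<in> W O dot S \<longleftrightarrow> (p, (t, t')) \<in> W \<and> (t, t') \<in> S"
  by (auto simp: dot_def)

lemma mem_lemb_iff: "((s, s'), (t, t')) \<in> lemb X c \<longleftrightarrow> (s, t) \<in> c \<and> s' = t' \<and> s' \<in> X"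
  by (auto simp: lemb_def)

text \<open>The intermediate pair is \<open>(t, s')\<close>. The identity component of
  \<open>lemb\<close> demands \<open>s' \<in> X\<close>, which follows from \<open>d\<close> lying
  in the carrier.\<close>

lemma mem_biprod_hav_iff:
  assumes "d \<in> rel_kat X"
  shows "((s, s'), (t, t')) \<in> biprod X (hav X) d \<longleftrightarrow> s \<in> X \<and> t \<in> X \<and> (s', t') \<in> d"
  using assms by (force simp: biprod_def lemb_def remb_def tensor_def hav_def rel_kat_def)

text \<open>Composing with \<open>hav\<close> on the right side forgets the final right-hand state
  of \<open>W\<close>; this produces the existential quantifier of the forward simulation.
  Membership of \<open>W\<close> in \<open>bikat X\<close> keeps the forgotten state in
  \<open>X\<close>.\<close>

lemma mem_relcomp_remb_hav_iff:
  assumes "W \<in> bikat X"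
  shows "(p, (t, t')) \<in> W O remb X (hav X) \<longleftrightarrow> t' \<in> X \<and> (\<exists>u'\<in>X. (p, (t, u')) \<in> W)"
  using assms by (fastforce simp: remb_def tensor_def hav_def bikat_def rel_kat_def)

text \<open>Here \<open>hav\<close> comes first, so the initial right-hand state is forgotten, as
  the backward simulation requires.\<close>

lemma mem_remb_hav_relcomp_iff:
  assumes "W \<in> bikat X"
  shows "((s, s'), q) \<in> remb X (hav X) O W \<longleftrightarrow> s' \<in> X \<and> (\<exists>u'\<in>X. ((s, u'), q) \<in> W)"
  using assms by (fastforce simp: remb_def tensor_def hav_def bikat_def rel_kat_def)

lemma alignment_in_bikat:
  assumes "c \<in> rel_kat X" and "d \<in> rel_kat X"
  shows "dot R O tensor c d O dot S \<in> bikat X"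
  using assms by (fastforce simp: bikat_def rel_kat_def dot_def tensor_def)

text \<open>Exposes all four state components, so that the membership rules above, phrased for
  explicit pairs, can rewrite.\<close>

lemma pair_rel_subsetI:
  assumes "\<And>s s' t t'. ((s, s'), (t, t')) \<in> A \<Longrightarrow> ((s, s'), (t, t')) \<in> B"
  shows "A \<subseteq> B"
  using assms by auto

theorem forward_simulation_iff_alignment:
  assumes "c \<in> rel_kat X" and "d \<in> rel_kat X" and "R \<in> rel_kat X"
  shows
    "(\<forall>\<sigma>\<in>X. \<forall>\<sigma>'\<in>X. \<forall>\<tau>\<in>X. (\<sigma>, \<sigma>') \<in> R \<and> (\<sigma>, \<tau>) \<in> c \<longrightarrow>
        (\<exists>\<tau>'\<in>X. (\<sigma>', \<tau>') \<in> d \<and> (\<tau>, \<tau>') \<in> S))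
     \<longleftrightarrow>
     (\<exists>W\<in>bikat X.
        dot R O W \<subseteq> dot R O W O dot S \<and>
        dot R O lemb X c \<subseteq> W O remb X (hav X) \<and>
        dot R O W \<subseteq> biprod X (hav X) d)"
    (is "?sim \<longleftrightarrow> (\<exists>W\<in>bikat X. ?align W)")
proof
  assume sim: ?sim
  let ?W = "dot R O tensor c d O dot S"
  have W: "?W \<in> bikat X"
    using assms by (intro alignment_in_bikat)
  have carrier: "c \<subseteq> X \<times> X" "R \<subseteq> X \<times> X"
    using assms by (auto simp: rel_kat_def)
  \<comment> \<open>Immediate because the witness already ends with the test
    \<open>dot S\<close>.\<close>
  have "dot R O ?W \<subseteq> dot R O ?W O dot S"
    by (rule pair_rel_subsetI) simp
  moreover have "dot R O lemb X c \<subseteq> ?W O remb X (hav X)"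
  proof (rule pair_rel_subsetI)
    fix s s' t t' assume "((s, s'), (t, t')) \<in> dot R O lemb X c"
    then have "(s, s') \<in> R" "(s, t) \<in> c" "t' \<in> X"
      by (auto simp: mem_lemb_iff)
    \<comment> \<open>The state forgotten by \<open>hav\<close> is the answer of the simulation to
      the step from \<open>s\<close> to \<open>t\<close>; \<open>carrier\<close> discharges its
      bounded quantifiers.\<close>
    with sim carrier show "((s, s'), (t, t')) \<in> ?W O remb X (hav X)"
      unfolding mem_relcomp_remb_hav_iff[OF W] by simp blast
  qed
  moreover have "dot R O ?W \<subseteq> biprod X (hav X) d"
    using carrier by (intro pair_rel_subsetI) (auto simp: mem_biprod_hav_iff[OF assms(2)])
  ultimately show "\<exists>W\<in>bikat X. ?align W"
    using W by blast
next
  assume "\<exists>W\<in>bikat X. ?align W"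
  then obtain W where W: "W \<in> bikat X" and align: "?align W"
    by blast
  show ?sim
  proof (intro ballI impI, elim conjE)
    fix s s' t assume X: "s \<in> X" "s' \<in> X" and R: "(s, s') \<in> R" and c: "(s, t) \<in> c"
    \<comment> \<open>Under \<open>lemb X c\<close> the right side idles at \<open>s'\<close>; the
      matching final state is then read off from \<open>W\<close>.\<close>
    then have "((s, s'), (t, s')) \<in> W O remb X (hav X)"
      using align by (auto simp: mem_lemb_iff)
    then obtain t' where t': "t' \<in> X" and "((s, s'), (t, t')) \<in> W"
      unfolding mem_relcomp_remb_hav_iff[OF W] by blast
    \<comment> \<open>The other two conditions constrain \<open>W\<close> only behind the test
      \<open>dot R\<close>.\<close>
    with R have "((s, s'), (t, t')) \<in> dot R O W"
      by simp
    with align have "((s, s'), (t, t')) \<in> dot R O W O dot S"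
      and "((s, s'), (t, t')) \<in> biprod X (hav X) d"
      by blast+
    with t' show "\<exists>t'\<in>X. (s', t') \<in> d \<and> (t, t') \<in> S"
      by (auto simp: mem_biprod_hav_iff[OF assms(2)])
  qed
qed

text \<open>This is the forward case with time reversed: taking converses swaps the roles of
  \<open>R\<close> and \<open>S\<close>, so the carrier hypothesis falls on
  \<open>S\<close>.\<close>

theorem backward_simulation_iff_alignment:
  assumes "c \<in> rel_kat X" and "d \<in> rel_kat X" and "S \<in> rel_kat X"
  shows
    "(\<forall>\<sigma>\<in>X. \<forall>\<tau>\<in>X. \<forall>\<tau>'\<in>X. (\<sigma>, \<tau>) \<in> c \<and> (\<tau>, \<tau>') \<in> S \<longrightarrow>
        (\<exists>\<sigma>'\<in>X. (\<sigma>, \<sigma>') \<in> R \<and> (\<sigma>', \<tau>') \<in> d))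
     \<longleftrightarrow>
     (\<exists>W\<in>bikat X.
        W O dot S \<subseteq> dot R O W O dot S \<and>
        lemb X c O dot S \<subseteq> remb X (hav X) O W \<and>
        W O dot S \<subseteq> biprod X (hav X) d)"
    (is "?sim \<longleftrightarrow> (\<exists>W\<in>bikat X. ?align W)")
proof
  assume sim: ?sim
  let ?W = "dot R O tensor c d O dot S"
  have W: "?W \<in> bikat X"
    using assms by (intro alignment_in_bikat)
  have carrier: "c \<subseteq> X \<times> X" "S \<subseteq> X \<times> X"
    using assms by (auto simp: rel_kat_def)
  have "?W O dot S \<subseteq> dot R O ?W O dot S"
    by (rule pair_rel_subsetI) simp
  moreover have "lemb X c O dot S \<subseteq> remb X (hav X) O ?W"
  proof (rule pair_rel_subsetI)
    fix s s' t t' assume "((s, s'), (t, t')) \<in> lemb X c O dot S"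
    then have "(s, t) \<in> c" "(t, t') \<in> S" "s' \<in> X"
      by (auto simp: mem_lemb_iff)
    with sim carrier show "((s, s'), (t, t')) \<in> remb X (hav X) O ?W"
      unfolding mem_remb_hav_relcomp_iff[OF W] by simp blast
  qed
  moreover have "?W O dot S \<subseteq> biprod X (hav X) d"
    using carrier by (intro pair_rel_subsetI) (auto simp: mem_biprod_hav_iff[OF assms(2)])
  ultimately show "\<exists>W\<in>bikat X. ?align W"
    using W by blast
next
  assume "\<exists>W\<in>bikat X. ?align W"
  then obtain W where W: "W \<in> bikat X" and align: "?align W"
    by blast
  show ?sim
  proof (intro ballI impI, elim conjE)
    fix s t t' assume X: "t' \<in> X" and c: "(s, t) \<in> c" and S: "(t, t') \<in> S"
    \<comment> \<open>The right side now idles at its final state \<open>t'\<close>, and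
      \<open>W\<close> supplies the initial state from which \<open>t'\<close> is reached.\<close>
    then have "((s, t'), (t, t')) \<in> remb X (hav X) O W"
      using align by (auto simp: mem_lemb_iff)
    then obtain s' where s': "s' \<in> X" and "((s, s'), (t, t')) \<in> W"
      unfolding mem_remb_hav_relcomp_iff[OF W] by blast
    with S have "((s, s'), (t, t')) \<in> W O dot S"
      by simp
    with align have "((s, s'), (t, t')) \<in> dot R O W O dot S"
      and "((s, s'), (t, t')) \<in> biprod X (hav X) d"
      by blast+
    with s' show "\<exists>s'\<in>X. (s, s') \<in> R \<and> (s', t') \<in> d"
      by (auto simp: mem_biprod_hav_iff[OF assms(2)])
  qed
qed

theorem theorem7p3:
  fixes X :: "'a set" and c d R S :: "'a rel"
  assumes "c \<in> rel_kat X" and "d \<in> rel_kat X" and "R \<in> rel_kat X" and "S \<in> rel_kat X"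
  shows
    "((\<forall>\<sigma>\<in>X. \<forall>\<sigma>'\<in>X. \<forall>\<tau>\<in>X. (\<sigma>, \<sigma>') \<in> R \<and> (\<sigma>, \<tau>) \<in> c \<longrightarrow>
          (\<exists>\<tau>'\<in>X. (\<sigma>', \<tau>') \<in> d \<and> (\<tau>, \<tau>') \<in> S))
      \<longleftrightarrow>
      (\<exists>W\<in>bikat X.
          dot R O W \<subseteq> dot R O W O dot S \<and>
          dot R O lemb X c \<subseteq> W O remb X (hav X) \<and>
          dot R O W \<subseteq> biprod X (hav X) d))
     \<and>
     ((\<forall>\<sigma>\<in>X. \<forall>\<tau>\<in>X. \<forall>\<tau>'\<in>X. (\<sigma>, \<tau>) \<in> c \<and> (\<tau>, \<tau>') \<in> S \<longrightarrow>
          (\<exists>\<sigma>'\<in>X. (\<sigma>, \<sigma>') \<in> R \<and> (\<sigma>', \<tau>') \<in> d))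
      \<longleftrightarrow>
      (\<exists>W\<in>bikat X.
          W O dot S \<subseteq> dot R O W O dot S \<and>
          lemb X c O dot S \<subseteq> remb X (hav X) O W \<and>
          W O dot S \<subseteq> biprod X (hav X) d))"
  using forward_simulation_iff_alignment[OF assms(1-3)]
    backward_simulation_iff_alignment[OF assms(1,2,4)]
  by (rule conjI)

end
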